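(* $(\mathcal{W},<_0)$ is a well-founded relation.
   Context: $\mathcal{W}$ is the set of formulas of the calculus $\mathsf{RC}^0$, defined inductively by $F::=\top\mid F\land F\mid\Diamond_nF$, where $n$ ranges over $\mathbb{N}$. A sequent is an expression $A\vdash B$ with $A,B\in\mathcal{W}$. The axioms and rules of $\mathsf{RC}^0$ are: (1) $A\vdash A$; $A\vdash\top$; if $A\vdash B$ and $B\vdash C$ then $A\vdash C$; (2) $A\land B\vdash A$; $A\land B\vdash B$; if $A\vdash B$ and $A\vdash C$ then $A\vdash B\land C$; (3) if $A\vdash B$ then $\Diamond_nA\vdash\Diamond_nB$, for all $n\in\mathbb{N}$; (4) $\Diamond_n\Diamond_nA\vdash\Diamond_nA$, for every $n\in\mathbb{N}$; (5) $\Diamond_nA\vdash\Diamond_mA$, for all $n>m$; (6) $\Diamond_nA\land\Diamond_mB\vdash\Diamond_n(A\land\Diamond_mB)$, for all $n>m$. For $A,B\in\mathcal{W}$, $A<_0B$ means that $B\vdash\Diamond_0A$ is derivable in $\mathsf{RC}^0$. *)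

theory Defs
  imports Main
begin

datatype rc_formula =
    Top
  | Conj rc_formula rc_formula (infixr "\<^bold>\<and>" 65)
  | Diamond nat rc_formula

inductive rc0 :: "rc_formula \<Rightarrow> rc_formula \<Rightarrow> bool" (infix "\<turnstile>" 50) where
  refl: "A \<turnstile> A"
| top: "A \<turnstile> Top"
| cut: "A \<turnstile> B \<Longrightarrow> B \<turnstile> C \<Longrightarrow> A \<turnstile> C"
| conj_left: "A \<^bold>\<and> B \<turnstile> A"
| conj_right: "A \<^bold>\<and> B \<turnstile> B"
| conj_intro: "A \<turnstile> B \<Longrightarrow> A \<turnstile> C \<Longrightarrow> A \<turnstile> B \<^bold>\<and> C"
| diamond_mono: "A \<turnstile> B \<Longrightarrow> Diamond n A \<turnstile> Diamond n B"
| diamond_trans: "Diamond n (Diamond n A) \<turnstile> Diamond n A"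
| diamond_down: "n > m \<Longrightarrow> Diamond n A \<turnstile> Diamond m A"
| diamond_conj: "n > m \<Longrightarrow> Diamond n A \<^bold>\<and> Diamond m B \<turnstile> Diamond n (A \<^bold>\<and> Diamond m B)"

definition less0 :: "rc_formula \<Rightarrow> rc_formula \<Rightarrow> bool" (infix "<\<^sub>0" 50) where
  "A <\<^sub>0 B \<longleftrightarrow> B \<turnstile> Diamond 0 A"

end

theory Submission
  imports Defs
begin

text \<open>
  Write \<open>l \<alpha>\<close> for the last exponent in the Cantor normal form of an ordinal \<open>\<alpha> < \<epsilon>\<^sub>0\<close>, with \<open>l 0 = 0\<close>.
  Formulas are evaluated at such ordinals, where \<open>\<alpha>\<close> sees \<open>\<beta>\<close> along \<open>\<Diamond>\<^sub>n\<close> iff \<open>l\<^sup>i \<beta> < l\<^sup>i \<alpha>\<close> for all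
  \<open>i \<le> n\<close>. Truth is preserved when every \<open>l\<^sup>i \<alpha>\<close> increases weakly, and this persistence yields
  axiom (6), which fails on the frame for arbitrary valuations: the witness \<open>\<beta>\<close> of \<open>\<Diamond>\<^sub>n A\<close> may be
  replaced by the least ordinal above \<open>\<beta>\<close> and \<open>\<delta>\<close> with a prescribed last exponent, where \<open>\<delta>\<close> is the
  witness of \<open>\<Diamond>\<^sub>m B\<close>. Every formula is true somewhere, and \<open>\<Diamond>\<^sub>0\<close> moves to a smaller ordinal, so a
  descending \<open><\<^sub>0\<close>-chain would give a descending chain of ordinals.
\<close>

section \<open>Ordinal notations\<close>

text \<open>\<open>Plus a b\<close> stands for \<open>a + \<omega>\<^bsup>b\<^esup>\<close>. Terms need not be in normal form, so different terms may denote
  the same ordinal and \<open>ord_less\<close> is only a strict weak order.\<close>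

datatype ord_term = Zero | Plus ord_term ord_term

text \<open>In the last clause, adding \<omega>^b to \<open>a\<close> stays below c + \<omega>^d
  because \<omega>^d is additively indecomposable.\<close>

function ord_less :: "ord_term \<Rightarrow> ord_term \<Rightarrow> bool" (infix "\<prec>" 50) where
  "x \<prec> Zero \<longleftrightarrow> False"
| "Zero \<prec> Plus c d \<longleftrightarrow> True"
| "Plus a b \<prec> Plus c d \<longleftrightarrow> \<not> c \<prec> Plus a b \<or> b \<prec> d \<and> a \<prec> Plus c d"
  by pat_completeness auto
termination by (relation "measure (\<lambda>(x, y). size x + size y)") auto

abbreviation ord_le :: "ord_term \<Rightarrow> ord_term \<Rightarrow> bool" (infix "\<preceq>" 50) where
  "x \<preceq> y \<equiv> \<not> y \<prec> x"

text \<open>The weights let two copies of a proper subterm count for less than the whole term, as the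
  mutual induction for asymmetry (on \<open>x, x, y, y\<close>) and transitivity (on \<open>x, y, z\<close>) requires.\<close>

primrec weight :: "ord_term \<Rightarrow> nat" where
  "weight Zero = 1"
| "weight (Plus a b) = 2 * weight a + 2 * weight b + 1"

lemma ord_less_irrefl: "\<not> x \<prec> x"
proof (induction x)
  case (Plus a b)
  then have "a \<prec> Plus a b" by (cases a) auto
  with Plus show ?case by simp
qed simp

lemma less_Plus: "x \<prec> Plus x y"
  using ord_less_irrefl by (cases x) auto

lemma ord_less_asym_cotrans:
  "(2 * weight x + 2 * weight y = n \<longrightarrow> x \<prec> y \<longrightarrow> \<not> y \<prec> x) \<and>
   (weight x + weight y + weight z = n \<longrightarrow> x \<prec> z \<longrightarrow> x \<prec> y \<or> y \<prec> z)"
proof (induction n arbitrary: x y z rule: less_induct)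
  case (less n)
  have asym: "\<not> v \<prec> u" if "u \<prec> v" "2 * weight u + 2 * weight v < n" for u v
    using less that by blast
  have cotrans: "u \<prec> v \<or> v \<prec> w" if "u \<prec> w" "weight u + weight v + weight w < n" for u v w
    using less that by blast
  have "\<not> y \<prec> x" if n: "2 * weight x + 2 * weight y = n" and xy: "x \<prec> y"
  proof
    assume yx: "y \<prec> x"
    obtain a b where x: "x = Plus a b" using yx by (cases x) auto
    obtain c d where y: "y = Plus c d" using xy by (cases y) auto
    have "\<not> (b \<prec> d \<and> d \<prec> b)"
      using asym[of b d] n x y by auto
    \<comment> \<open>The first alternative of either comparison contradicts the second alternative
      of the other.\<close>
    then have "x \<preceq> c" "y \<preceq> a"
      using xy yx x y by auto
    then have "a \<prec> c" "c \<prec> a"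
      using cotrans[of a x c] cotrans[of c y a] less_Plus n x y by auto
    then show False
      using asym[of a c] n x y by auto
  qed
  moreover have "x \<prec> y \<or> y \<prec> z" if n: "weight x + weight y + weight z = n" and xz: "x \<prec> z"
  proof (rule ccontr)
    assume "\<not> (x \<prec> y \<or> y \<prec> z)"
    then have yx: "y \<preceq> x" and zy: "z \<preceq> y" by auto
    obtain e f where z: "z = Plus e f" using xz by (cases z) auto
    obtain c d where y: "y = Plus c d" using zy z by (cases y) auto
    obtain a b where x: "x = Plus a b" using yx y by (cases x) auto
    have cx: "c \<prec> x" and bd: "d \<preceq> b \<or> y \<preceq> a" using yx x y by auto
    have ey: "e \<prec> y" and df: "f \<preceq> d \<or> z \<preceq> c" using zy z y by auto
    have "e \<prec> x" using cotrans[OF ey, of x] yx n z by auto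
    then have bf: "b \<prec> f" and az: "a \<prec> z" using xz x z by auto
    have "a \<prec> y \<or> y \<prec> z" using cotrans[OF az, of y] n x by auto
    then have "d \<preceq> b" using bd zy by auto
    then have "d \<prec> f" using cotrans[OF bf, of d] n x y z by auto
    then have "z \<preceq> c" using df by auto
    \<comment> \<open>It remains to exclude \<open>z \<preceq> c \<prec> x\<close>; asymmetry of \<open>x\<close> and \<open>z\<close> is not yet available.\<close>
    moreover have "\<not> (z \<preceq> u \<and> u \<prec> x)" if "weight u < weight y" for u
      using that
    proof (induction u)
      case (Plus u v)
      show ?case
      proof
        assume *: "z \<preceq> Plus u v \<and> Plus u v \<prec> x"
        have "a \<prec> Plus u v \<or> Plus u v \<prec> z"
          using cotrans[OF az, of "Plus u v"] n x Plus.prems by auto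
        then have vb: "v \<prec> b" and ux: "u \<prec> x" using * x by auto
        have "v \<prec> f \<or> f \<prec> b"
          using cotrans[OF vb, of f] n x z Plus.prems by auto
        moreover have "\<not> f \<prec> b" using asym[OF bf] n x z by auto
        ultimately have "z \<preceq> u" using * z by auto
        then show False using Plus ux by auto
      qed
    qed (simp add: z)
    moreover have "weight c < weight y" using y by simp
    ultimately show False using cx by blast
  qed
  ultimately show ?case by blast
qed

lemma ord_less_asym: "x \<prec> y \<Longrightarrow> x \<preceq> y"
  using ord_less_asym_cotrans by metis

lemma ord_less_le_trans: "x \<prec> y \<Longrightarrow> y \<preceq> z \<Longrightarrow> x \<prec> z"
  using ord_less_asym_cotrans by metis

lemma ord_le_less_trans: "x \<preceq> y \<Longrightarrow> y \<prec> z \<Longrightarrow> x \<prec> z"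
  using ord_less_asym_cotrans by metis

lemma ord_less_trans: "x \<prec> y \<Longrightarrow> y \<prec> z \<Longrightarrow> x \<prec> z"
  by (metis ord_less_asym ord_less_le_trans)

lemma ord_le_trans: "x \<preceq> y \<Longrightarrow> y \<preceq> z \<Longrightarrow> x \<preceq> z"
  by (metis ord_le_less_trans)

lemma accp_Zero: "Wellfounded.accp (\<prec>) Zero"
  by (rule accp.accI) simp

text \<open>A term strictly between \<open>a\<close> and \<open>Plus a b\<close> has last exponent
  below \<open>b\<close>, and its prefix is again below \<open>Plus a b\<close>; hence an induction
  on terms inside the one on \<open>b\<close>.\<close>

lemma accp_Plus:
  assumes "Wellfounded.accp (\<prec>) b"
  shows "Wellfounded.accp (\<prec>) a \<Longrightarrow> Wellfounded.accp (\<prec>) (Plus a b)"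
  using assms
proof (induction arbitrary: a rule: accp.induct)
  case (accI b)
  have "Wellfounded.accp (\<prec>) y" if "y \<prec> Plus a b" for y
    using that
  proof (induction y)
    case (Plus c e)
    show ?case
    proof (cases "Plus c e \<preceq> a")
      case True
      then show ?thesis
        using accI.prems ord_less_le_trans by (metis accp.simps)
    next
      case False
      then have "e \<prec> b" "c \<prec> Plus a b" using Plus.prems by auto
      then show ?thesis using Plus.IH accI.IH by blast
    qed
  qed (rule accp_Zero)
  then show ?case by (rule accp.accI)
qed

lemma wfp_ord_less: "wfp (\<prec>)"
proof (rule accp_wfpI, rule allI)
  show "Wellfounded.accp (\<prec>) x" for x
    by (induction x) (auto intro: accp_Zero accp_Plus)
qed

section \<open>Last exponents and the frame\<close>

primrec last_exp :: "ord_term \<Rightarrow> ord_term" where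
  "last_exp Zero = Zero"
| "last_exp (Plus a b) = b"

text \<open>\<open>Plus x y\<close> is the least ordinal above \<open>x\<close> with last exponent \<open>y\<close>, even among those with last
  exponent at least \<open>y\<close>.\<close>

lemma Plus_less: "x \<prec> z \<Longrightarrow> y \<prec> last_exp z \<Longrightarrow> Plus x y \<prec> z"
  by (cases z) auto

lemma upper_bound:
  obtains z where "x \<preceq> z" "y \<preceq> z" "z = x \<or> z = y"
  by (metis ord_less_asym ord_less_irrefl)

definition dominates :: "ord_term \<Rightarrow> ord_term \<Rightarrow> bool" where
  "dominates x y \<longleftrightarrow> (\<forall>i. (last_exp ^^ i) y \<preceq> (last_exp ^^ i) x)"

lemma dominates_iff: "dominates x y \<longleftrightarrow> y \<preceq> x \<and> dominates (last_exp x) (last_exp y)"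
proof -
  have "(\<forall>i. P i) \<longleftrightarrow> P 0 \<and> (\<forall>i. P (Suc i))" for P :: "nat \<Rightarrow> bool"
    by (metis nat.exhaust)
  from this[of "\<lambda>i. (last_exp ^^ i) y \<preceq> (last_exp ^^ i) x"] show ?thesis
    by (simp add: dominates_def funpow_swap1)
qed

lemma dominates_refl: "dominates x x"
  by (simp add: dominates_def ord_less_irrefl)

lemma dominates_Zero: "dominates x Zero"
proof -
  have "(last_exp ^^ i) Zero = Zero" for i by (induction i) auto
  then show ?thesis by (auto simp: dominates_def)
qed

text \<open>Serves to merge models of two conjuncts: a common bound of the last exponents is
  appended to the larger ordinal.\<close>

lemma dominates_directed: "\<exists>z. dominates z x \<and> dominates z y"
proof (induction x arbitrary: y)
  case Zero
  show ?case using dominates_Zero dominates_refl by blast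
next
  case (Plus a b)
  obtain w where w: "dominates w b" "dominates w (last_exp y)"
    using Plus.IH(2) by blast
  obtain u where "Plus a b \<preceq> u" "y \<preceq> u" by (rule upper_bound)
  then have "Plus a b \<preceq> Plus u w" "y \<preceq> Plus u w"
    by (metis less_Plus ord_less_asym ord_le_trans)+
  then have "dominates (Plus u w) (Plus a b)" "dominates (Plus u w) y"
    using w by (auto simp: dominates_iff[of "Plus u w"])
  then show ?case by blast
qed

primrec sees :: "nat \<Rightarrow> ord_term \<Rightarrow> ord_term \<Rightarrow> bool" where
  "sees 0 x y \<longleftrightarrow> y \<prec> x"
| "sees (Suc n) x y \<longleftrightarrow> y \<prec> x \<and> sees n (last_exp x) (last_exp y)"

lemma sees_less: "sees n x y \<Longrightarrow> y \<prec> x"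
  by (cases n) auto

lemma sees_trans: "sees n x y \<Longrightarrow> sees n y z \<Longrightarrow> sees n x z"
  by (induction n arbitrary: x y z) (auto intro: ord_less_trans)

lemma sees_antimono: "m \<le> n \<Longrightarrow> sees n x y \<Longrightarrow> sees m x y"
proof (induction m arbitrary: n x y)
  case 0
  then show ?case by (auto dest: sees_less)
next
  case (Suc m)
  then show ?case by (cases n) auto
qed

lemma dominates_sees: "dominates x y \<Longrightarrow> sees n y z \<Longrightarrow> sees n x z"
proof (induction n arbitrary: x y z)
  case 0
  then show ?case by (metis dominates_iff ord_less_le_trans sees.simps(1))
next
  case (Suc n)
  then show ?case by (metis dominates_iff ord_less_le_trans sees.simps(2))
qed

lemma sees_serial: "\<exists>x. sees n x y"
proof (induction n arbitrary: y)
  case 0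
  show ?case using less_Plus by auto
next
  case (Suc n)
  then obtain w where "sees n w (last_exp y)" by blast
  then have "sees (Suc n) (Plus y w) y" using less_Plus by simp
  then show ?case by blast
qed

lemma sees_interpolate:
  assumes "m < n" "sees n x y" "sees m x z"
  shows "\<exists>y'. dominates y' y \<and> sees n x y' \<and> sees m y' z"
  using assms
proof (induction m arbitrary: n x y z)
  case 0
  then obtain k where k: "n = Suc k" by (cases n) auto
  obtain u where u: "y \<preceq> u" "z \<preceq> u" "u = y \<or> u = z" by (rule upper_bound)
  \<comment> \<open>Keeping the last exponent of \<open>y\<close> leaves all deeper levels
    unchanged, so only level 0 needs checking.\<close>
  let ?y = "Plus u (last_exp y)"
  have gt: "y \<prec> ?y" "z \<prec> ?y"
    using u(1,2) by (auto intro: ord_le_less_trans[OF _ less_Plus])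
  have "u \<prec> x" using u(3) 0 sees_less by auto
  moreover have "last_exp y \<prec> last_exp x" using 0 k sees_less by auto
  ultimately have "?y \<prec> x" by (rule Plus_less)
  then have "sees n x ?y" using 0 k by simp
  moreover have "dominates ?y y"
    using ord_less_asym[OF gt(1)] by (simp add: dominates_iff[of ?y] dominates_refl)
  ultimately show ?case using gt by auto
next
  case (Suc m)
  then obtain k where k: "n = Suc k" "m < k" by (cases n) auto
  with Suc obtain w where w: "dominates w (last_exp y)" "sees k (last_exp x) w"
      "sees m w (last_exp z)"
    by force
  obtain u where u: "y \<preceq> u" "z \<preceq> u" "u = y \<or> u = z" by (rule upper_bound)
  \<comment> \<open>\<open>w\<close> settles the deeper levels, and appending it to \<open>u\<close>
    settles level 0.\<close>
  let ?y = "Plus u w"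
  have gt: "y \<prec> ?y" "z \<prec> ?y"
    using u(1,2) by (auto intro: ord_le_less_trans[OF _ less_Plus])
  have "u \<prec> x" using u(3) Suc.prems sees_less by auto
  then have "?y \<prec> x" using w(2) sees_less by (blast intro: Plus_less)
  then have "sees n x ?y" using w k by simp
  moreover have "dominates ?y y"
    using ord_less_asym[OF gt(1)] w by (simp add: dominates_iff[of ?y])
  ultimately show ?case using gt w by auto
qed

section \<open>Soundness and satisfiability\<close>

primrec sat :: "ord_term \<Rightarrow> rc_formula \<Rightarrow> bool" where
  "sat x Top \<longleftrightarrow> True"
| "sat x (A \<^bold>\<and> B) \<longleftrightarrow> sat x A \<and> sat x B"
| "sat x (Diamond n A) \<longleftrightarrow> (\<exists>y. sees n x y \<and> sat y A)"

lemma sat_dominates: "dominates x y \<Longrightarrow> sat y A \<Longrightarrow> sat x A"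
  by (induction A) (auto intro: dominates_sees)

lemma sat_sound: "A \<turnstile> B \<Longrightarrow> sat x A \<Longrightarrow> sat x B"
proof (induction arbitrary: x rule: rc0.induct)
  case (diamond_trans n A)
  then show ?case by (auto intro: sees_trans)
next
  case (diamond_down n m A)
  then show ?case using less_imp_le sees_antimono by (metis sat.simps(3))
next
  case (diamond_conj n m A B)
  then obtain y z where "sees n x y" "sat y A" "sees m x z" "sat z B" by auto
  with sees_interpolate[OF diamond_conj(1)] obtain y'
    where "dominates y' y" "sees n x y'" "sees m y' z" by blast
  then show ?case using sat_dominates \<open>sat y A\<close> \<open>sat z B\<close> by auto
qed auto

lemma satisfiable: "\<exists>x. sat x A"
proof (induction A)
  case (Conj A B)
  then show ?case using dominates_directed sat_dominates by (metis sat.simps(2))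
next
  case (Diamond n A)
  then show ?case using sees_serial by (metis sat.simps(3))
qed simp

lemma sat_accp: "sat x B \<Longrightarrow> Wellfounded.accp (<\<^sub>0) B"
proof (induction x arbitrary: B rule: wfp_induct_rule[OF wfp_ord_less])
  case (1 x)
  have "Wellfounded.accp (<\<^sub>0) A" if "A <\<^sub>0 B" for A
  proof -
    have "sat x (Diamond 0 A)"
      using that 1(2) unfolding less0_def by (rule sat_sound)
    then show ?thesis using 1(1) by auto
  qed
  then show ?case by (rule accp.accI)
qed

theorem theorem6p2:
  shows "wfp (<\<^sub>0)"
  using satisfiable sat_accp by (blast intro: accp_wfpI)

end
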